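(* Let $(\mathcal S,\mathcal A,P,R,\gamma)$ be a finite MDP with bisimulation metric $d$, let $\mathcal C$ be a fixed set of unordered pairs of distinct states (covered pairs), let $d_0$ be a pair function with $0\le d_0\le d$, and let $B$ be an $\varepsilon_{\mathrm{op}}$-approximate covered backup, $\varepsilon_{\mathrm{op}}\ge0$. Let $f_0=d_0$ and, for $t\ge0$, $f_{t+1}=Bf_t$ on $\mathcal C$ and $f_{t+1}=d_0$ off $\mathcal C$. Put $\Delta_0:=\|d_0-d\|_\infty$, $\rho:=\max_{p\notin\mathcal C}(d(p)-d_0(p))$ and $e_t:=\max_{p\in\mathcal C}|f_t(p)-d(p)|$. Then for every $t\ge0$: (A) $e_t\le\max\Big(\dfrac{\varepsilon_{\mathrm{op}}}{1-\gamma},\ \varepsilon_{\mathrm{op}}+\gamma\rho\Big)+\gamma^t\Delta_0$. (B) $\|f_t-d\|_\infty\le\max\Big(\rho,\ \dfrac{\varepsilon_{\mathrm{op}}}{1-\gamma}\Big)+\gamma^t\Delta_0$, and every limit point $\hat d$ of $(f_t)$ satisfies $\|\hat d-d\|_\infty\le\max\big(\rho,\ \varepsilon_{\mathrm{op}}/(1-\gamma)\big)$. (C) If $\mathcal C$ contains all pairs, then $\rho=0$ and (B) reads $\|f_t-d\|_\infty\le\varepsilon_{\mathrm{op}}/(1-\gamma)+\gamma^t\Delta_0$. (D) If $B$ is the exact backup ($Bf=Tf$ on $\mathcal C$) and $d_0\in\{0,d_R\}$, or more generally $d_0$ is any sub-solution ($Td_0\ge d_0$ on $\mathcal C$), then $f_t$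 increases monotonically to the unique fixed point $\hat d$ of the restricted iteration (the unique pair function with $\hat d=T\hat d$ on $\mathcal C$ and $\hat d=d_0$ off $\mathcal C$), $d_0\le\hat d\le d$ pointwise, and $\max_{p\in\mathcal C}|\hat d(p)-d(p)|\le\gamma\rho$.
   Context: The MDP has finite $\mathcal S$, finite nonempty $\mathcal A$, transition kernel $P(\cdot\mid s,a)$, reward $R:\mathcal S\times\mathcal A\to[0,L]$, and $\gamma\in[0,1)$. A pair function is a real symmetric function on $\mathcal S\times\mathcal S$ vanishing on the diagonal, regarded as a function on unordered pairs of distinct states; $\|f\|_\infty=\max_{s,s'}|f(s,s')|$, and inequalities are pointwise. For a pair function $f$ and distributions $\mu,\nu$ on $\mathcal S$, $W_1^f(\mu,\nu)=\min_\pi\sum_{x,y}f(x,y)\pi(x,y)$ over couplings $\pi$ of $\mu,\nu$ ($f$ need not satisfy the triangle inequality). For $s\neq s'$, $$(Tf)(s,s')=\max_{a\in\mathcal A}\big[|R(s,a)-R(s',a)|+\gamma W_1^f(P(\cdot\mid s,a),P(\cdot\mid s',a))\big].$$ $T$ is a $\gamma$-contraction in $\|\cdot\|_\infty$; the bisimulation metric $d$ is its unique fixed point. $D_\gamma:=L/(1-\gamma)$ (and $0\le d\le D_\gamma$), $d_R(s,s'):=\max_a|R(s,a)-R(s',a)|$. An $\varepsilon_{\mathrm{op}}$-approximate covered backup is a map $B$ assigning to each pair function $f$ values $Bf(p)$, $p\in\mathcal C$, such that $|Bf(p)-Tf(p)|\le\varepsilon_{\mathrm{op}}$ for every $p\in\mathcal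 C$ and every pair function $f$ with $\|f\|_\infty\le D_\gamma+\varepsilon_{\mathrm{op}}/(1-\gamma)$. Pairs "off $\mathcal C$" are unordered pairs of distinct states not in $\mathcal C$. A maximum over an empty set is $0$. *)

theory Defs
  imports "HOL-Probability.Probability"
begin

definition pair_function :: "('s \<Rightarrow> 's \<Rightarrow> real) \<Rightarrow> bool" where
  "pair_function f \<longleftrightarrow> (\<forall>s s'. f s s' = f s' s) \<and> (\<forall>s. f s s = 0)"

definition sup_norm :: "('s::finite \<Rightarrow> 's \<Rightarrow> real) \<Rightarrow> real" where
  "sup_norm f = Max {\<bar>f s s'\<bar> | s s'. True}"

definition couplings :: "'s pmf \<Rightarrow> 's pmf \<Rightarrow> ('s \<times> 's) pmf set" where
  "couplings \<mu> \<nu> = {\<pi>. map_pmf fst \<pi> = \<mu> \<and> map_pmf snd \<pi> = \<nu>}"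

definition transport_cost :: "('s::finite \<Rightarrow> 's \<Rightarrow> real) \<Rightarrow> ('s \<times> 's) pmf \<Rightarrow> real" where
  "transport_cost f \<pi> = (\<Sum>x\<in>UNIV. \<Sum>y\<in>UNIV. f x y * pmf \<pi> (x, y))"

(* The infimum is a minimum: see W1_attained below. *)
definition W1 :: "('s::finite \<Rightarrow> 's \<Rightarrow> real) \<Rightarrow> 's pmf \<Rightarrow> 's pmf \<Rightarrow> real" where
  "W1 f \<mu> \<nu> = (INF \<pi>\<in>couplings \<mu> \<nu>. transport_cost f \<pi>)"

lemma W1_attained:
  fixes f :: "'s::finite \<Rightarrow> 's \<Rightarrow> real"
  shows "\<exists>\<pi>\<in>couplings \<mu> \<nu>. W1 f \<mu> \<nu> = transport_cost f \<pi> \<and>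
           (\<forall>\<pi>'\<in>couplings \<mu> \<nu>. transport_cost f \<pi> \<le> transport_cost f \<pi>')"
proof -
  define K :: "(real ^ ('s \<times> 's)) set" where
    "K = {v. (\<forall>i. 0 \<le> v $ i) \<and> (\<forall>x. (\<Sum>y\<in>UNIV. v $ (x, y)) = pmf \<mu> x)
            \<and> (\<forall>y. (\<Sum>x\<in>UNIV. v $ (x, y)) = pmf \<nu> y)}"
  define c :: "real ^ ('s \<times> 's) \<Rightarrow> real" where
    "c v = (\<Sum>x\<in>UNIV. \<Sum>y\<in>UNIV. f x y * v $ (x, y))" for v
  have fst_marg: "pmf (map_pmf fst \<pi>) x = (\<Sum>y\<in>UNIV. pmf \<pi> (x, y))"
    for \<pi> :: "('s \<times> 's) pmf" and x
  proof -
    have eq: "fst -` {x} = Pair x ` (UNIV :: 's set)" by auto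
    show ?thesis
      unfolding pmf_map eq
      by (subst measure_measure_pmf_finite) (auto simp: sum.reindex inj_on_def)
  qed
  have snd_marg: "pmf (map_pmf snd \<pi>) y = (\<Sum>x\<in>UNIV. pmf \<pi> (x, y))"
    for \<pi> :: "('s \<times> 's) pmf" and y
  proof -
    have eq: "snd -` {y} = (\<lambda>x. (x, y)) ` (UNIV :: 's set)" by auto
    show ?thesis
      unfolding pmf_map eq
      by (subst measure_measure_pmf_finite) (auto simp: sum.reindex inj_on_def)
  qed
  have to_K: "(\<chi> i. pmf \<pi> i) \<in> K \<and> c (\<chi> i. pmf \<pi> i) = transport_cost f \<pi>"
    if "\<pi> \<in> couplings \<mu> \<nu>" for \<pi>
    using that
    by (auto simp: K_def c_def couplings_def transport_cost_def fst_marg snd_marg)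
  have from_K: "\<exists>\<pi>\<in>couplings \<mu> \<nu>. transport_cost f \<pi> = c v" if v: "v \<in> K" for v
  proof -
    have nn: "0 \<le> v $ i" for i using v unfolding K_def by blast
    have "(\<Sum>i\<in>UNIV. v $ i) = (\<Sum>x\<in>UNIV. \<Sum>y\<in>UNIV. v $ (x, y))"
      by (simp add: sum.cartesian_product)
    also have "\<dots> = (\<Sum>x\<in>UNIV. pmf \<mu> x)" using v by (simp add: K_def)
    also have "\<dots> = 1" by (intro sum_pmf_eq_1) auto
    finally have "(\<integral>\<^sup>+ i. ennreal (v $ i) \<partial>count_space UNIV) = 1"
      by (simp add: nn_integral_count_space_finite sum_ennreal nn)
    with nn have emb: "pmf (embed_pmf (\<lambda>i. v $ i)) = (\<lambda>i. v $ i)"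
      by (intro ext pmf_embed_pmf) auto
    have "embed_pmf (\<lambda>i. v $ i) \<in> couplings \<mu> \<nu>"
      unfolding couplings_def using v
      by (auto intro!: pmf_eqI simp: fst_marg snd_marg emb K_def)
    moreover have "transport_cost f (embed_pmf (\<lambda>i. v $ i)) = c v"
      by (simp add: transport_cost_def c_def emb)
    ultimately show ?thesis by blast
  qed
  have "closed K"
    unfolding K_def by (intro closed_Collect_conj closed_Collect_all closed_Collect_le
        closed_Collect_eq continuous_intros)
  moreover have "bounded K"
  proof (rule boundedI)
    fix v assume v: "v \<in> K"
    have "norm v \<le> (\<Sum>i\<in>UNIV. \<bar>v $ i\<bar>)" by (rule norm_le_l1_cart)
    also have "\<dots> = (\<Sum>i\<in>UNIV. v $ i)"
      using v unfolding K_def by (intro sum.cong refl abs_of_nonneg) blast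
    also have "\<dots> = (\<Sum>x\<in>UNIV. \<Sum>y\<in>UNIV. v $ (x, y))"
      by (simp add: sum.cartesian_product)
    also have "\<dots> = (\<Sum>x\<in>UNIV. pmf \<mu> x)" using v by (simp add: K_def)
    also have "\<dots> = 1" by (intro sum_pmf_eq_1) auto
    finally show "norm v \<le> 1" .
  qed
  ultimately have "compact K" by (simp add: compact_eq_bounded_closed)
  moreover have "pair_pmf \<mu> \<nu> \<in> couplings \<mu> \<nu>"
    by (simp add: couplings_def map_fst_pair_pmf map_snd_pair_pmf)
  then have "K \<noteq> {}" using to_K by blast
  moreover have "continuous_on K c"
    unfolding c_def by (intro continuous_intros)
  ultimately obtain v where "v \<in> K" and v_min: "\<forall>w\<in>K. c v \<le> c w"
    using continuous_attains_inf by blast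
  then obtain \<pi> where \<pi>: "\<pi> \<in> couplings \<mu> \<nu>" "transport_cost f \<pi> = c v"
    using from_K by blast
  have le: "transport_cost f \<pi> \<le> transport_cost f \<pi>'" if "\<pi>' \<in> couplings \<mu> \<nu>" for \<pi>'
    using to_K[OF that] v_min \<pi>(2) by metis
  have "W1 f \<mu> \<nu> = transport_cost f \<pi>"
    unfolding W1_def using \<pi>(1) le by (intro cInf_eq_minimum) auto
  with \<pi>(1) le show ?thesis by blast
qed

definition bisim_op ::
  "('s::finite \<Rightarrow> 'a::finite \<Rightarrow> 's pmf) \<Rightarrow> ('s \<Rightarrow> 'a \<Rightarrow> real) \<Rightarrow> real \<Rightarrow>
   ('s \<Rightarrow> 's \<Rightarrow> real) \<Rightarrow> ('s \<Rightarrow> 's \<Rightarrow> real)" where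
  "bisim_op P R \<gamma> f s s' =
     (if s = s' then 0
      else (MAX a. \<bar>R s a - R s' a\<bar> + \<gamma> * W1 f (P s a) (P s' a)))"

definition bisim_metric ::
  "('s::finite \<Rightarrow> 'a::finite \<Rightarrow> 's pmf) \<Rightarrow> ('s \<Rightarrow> 'a \<Rightarrow> real) \<Rightarrow> real \<Rightarrow> ('s \<Rightarrow> 's \<Rightarrow> real)" where
  "bisim_metric P R \<gamma> = (THE d. pair_function d \<and> bisim_op P R \<gamma> d = d)"

definition reward_dist :: "('s \<Rightarrow> 'a::finite \<Rightarrow> real) \<Rightarrow> ('s \<Rightarrow> 's \<Rightarrow> real)" where
  "reward_dist R s s' = (MAX a. \<bar>R s a - R s' a\<bar>)"

definition state_pairs :: "'s set set" where
  "state_pairs = {{s, s'} | s s'. s \<noteq> s'}"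

(* A backup assigns values to unordered pairs; only those on the covered pairs matter. *)
definition approx_covered_backup ::
  "('s::finite \<Rightarrow> 'a::finite \<Rightarrow> 's pmf) \<Rightarrow> ('s \<Rightarrow> 'a \<Rightarrow> real) \<Rightarrow> real \<Rightarrow> real \<Rightarrow>
   's set set \<Rightarrow> real \<Rightarrow> (('s \<Rightarrow> 's \<Rightarrow> real) \<Rightarrow> 's set \<Rightarrow> real) \<Rightarrow> bool" where
  "approx_covered_backup P R \<gamma> L C \<epsilon> B \<longleftrightarrow>
     (\<forall>f. pair_function f \<and> sup_norm f \<le> L / (1 - \<gamma>) + \<epsilon> / (1 - \<gamma>) \<longrightarrow>
        (\<forall>s s'. {s, s'} \<in> C \<longrightarrow> \<bar>B f {s, s'} - bisim_op P R \<gamma> f s s'\<bar> \<le> \<epsilon>))"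

definition exact_covered_backup ::
  "('s::finite \<Rightarrow> 'a::finite \<Rightarrow> 's pmf) \<Rightarrow> ('s \<Rightarrow> 'a \<Rightarrow> real) \<Rightarrow> real \<Rightarrow>
   's set set \<Rightarrow> (('s \<Rightarrow> 's \<Rightarrow> real) \<Rightarrow> 's set \<Rightarrow> real) \<Rightarrow> bool" where
  "exact_covered_backup P R \<gamma> C B \<longleftrightarrow>
     (\<forall>f. pair_function f \<longrightarrow>
        (\<forall>s s'. {s, s'} \<in> C \<longrightarrow> B f {s, s'} = bisim_op P R \<gamma> f s s'))"

primrec covered_iter ::
  "'s set set \<Rightarrow> (('s \<Rightarrow> 's \<Rightarrow> real) \<Rightarrow> 's set \<Rightarrow> real) \<Rightarrow> ('s \<Rightarrow> 's \<Rightarrow> real) \<Rightarrow>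
   nat \<Rightarrow> ('s \<Rightarrow> 's \<Rightarrow> real)" where
  "covered_iter C B d0 0 = d0"
| "covered_iter C B d0 (Suc t) =
     (\<lambda>s s'. if {s, s'} \<in> C then B (covered_iter C B d0 t) {s, s'} else d0 s s')"

definition restricted_fixed_point ::
  "('s::finite \<Rightarrow> 'a::finite \<Rightarrow> 's pmf) \<Rightarrow> ('s \<Rightarrow> 'a \<Rightarrow> real) \<Rightarrow> real \<Rightarrow>
   's set set \<Rightarrow> ('s \<Rightarrow> 's \<Rightarrow> real) \<Rightarrow> ('s \<Rightarrow> 's \<Rightarrow> real) \<Rightarrow> bool" where
  "restricted_fixed_point P R \<gamma> C d0 g \<longleftrightarrow>
     pair_function g \<and>
     (\<forall>s s'. {s, s'} \<in> C \<longrightarrow> g s s' = bisim_op P R \<gamma> g s s') \<and>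
     (\<forall>s s'. {s, s'} \<notin> C \<longrightarrow> g s s' = d0 s s')"

definition Max0 :: "real set \<Rightarrow> real" where
  "Max0 A = (if A = {} then 0 else Max A)"

definition covered_error ::
  "'s set set \<Rightarrow> ('s \<Rightarrow> 's \<Rightarrow> real) \<Rightarrow> ('s \<Rightarrow> 's \<Rightarrow> real) \<Rightarrow> real" where
  "covered_error C f d = Max0 {\<bar>f s s' - d s s'\<bar> | s s'. {s, s'} \<in> C}"

definition uncovered_gap ::
  "'s set set \<Rightarrow> ('s \<Rightarrow> 's \<Rightarrow> real) \<Rightarrow> ('s \<Rightarrow> 's \<Rightarrow> real) \<Rightarrow> real" where
  "uncovered_gap C d0 d = Max0 {d s s' - d0 s s' | s s'. {s, s'} \<in> state_pairs - C}"

(* Pointwise convergence is sup-norm convergence, as the state space is finite. *)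
definition pointwise_limit ::
  "(nat \<Rightarrow> 's::finite \<Rightarrow> 's \<Rightarrow> real) \<Rightarrow> ('s \<Rightarrow> 's \<Rightarrow> real) \<Rightarrow> bool" where
  "pointwise_limit F g \<longleftrightarrow> (\<forall>s s'. (\<lambda>t. F t s s') \<longlonglongrightarrow> g s s')"

definition is_limit_point ::
  "(nat \<Rightarrow> 's::finite \<Rightarrow> 's \<Rightarrow> real) \<Rightarrow> ('s \<Rightarrow> 's \<Rightarrow> real) \<Rightarrow> bool" where
  "is_limit_point F g \<longleftrightarrow> (\<exists>r. strict_mono r \<and> pointwise_limit (F \<circ> r) g)"

end

theory Submission
  imports Defs
begin

text \<open>
  The optimal transport cost, and hence the backup operator \<open>T\<close>, is monotone and satisfies
  \<open>T f \<le> T g + \<gamma> c\<close> whenever \<open>f \<le> g + c\<close>; every estimate follows from this one inequality.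
  Writing \<open>M = max \<rho> (\<epsilon> / (1 - \<gamma>))\<close>, the error \<open>E\<^sub>t = \<parallel>f\<^sub>t - d\<parallel>\<close> is at most \<open>\<rho>\<close> off the covered
  pairs and satisfies \<open>E\<^sub>t\<^sub>+\<^sub>1 \<le> \<epsilon> + \<gamma> E\<^sub>t\<close> on them, and \<open>\<epsilon> + \<gamma> M \<le> M\<close>. For exact backups started from
  a sub-solution the iterates increase and are bounded, so they converge to a fixed point; with
  all pairs covered and start \<open>0\<close> this also yields existence of the bisimulation metric.
\<close>

section \<open>Suprema and maxima over finitely many pairs\<close>

lemma abs_le_sup_norm: "\<bar>f s s'\<bar> \<le> sup_norm f"
proof -
  have "{\<bar>f s s'\<bar> | s s'. True} = (\<lambda>(s, s'). \<bar>f s s'\<bar>) ` UNIV" by auto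
  then have "finite {\<bar>f s s'\<bar> | s s'. True}" by simp
  then show ?thesis unfolding sup_norm_def by (intro Max_ge) auto
qed

lemma sup_norm_le:
  assumes "\<And>s s'. \<bar>f s s'\<bar> \<le> c"
  shows "sup_norm f \<le> c"
proof -
  have "{\<bar>f s s'\<bar> | s s'. True} = (\<lambda>(s, s'). \<bar>f s s'\<bar>) ` UNIV" by auto
  then have "finite {\<bar>f s s'\<bar> | s s'. True}" by simp
  then show ?thesis unfolding sup_norm_def using assms by (subst Max_le_iff) auto
qed

lemma finite_pair_values: "finite {h s s' | s s'. Q s s'}"
  for h :: "'s::finite \<Rightarrow> 's \<Rightarrow> real"
  by (rule finite_subset[of _ "(\<lambda>(s, s'). h s s') ` UNIV"]) auto

lemma Max0_ge: "finite A \<Longrightarrow> x \<in> A \<Longrightarrow> x \<le> Max0 A"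
  by (auto simp: Max0_def)

lemma Max0_le:
  assumes "finite A" "0 \<le> c" "\<And>x. x \<in> A \<Longrightarrow> x \<le> c"
  shows "Max0 A \<le> c"
  using assms by (auto simp: Max0_def)

lemma covered_error_ge: "{s, s'} \<in> C \<Longrightarrow> \<bar>f s s' - d s s'\<bar> \<le> covered_error C f d"
  for f :: "'s::finite \<Rightarrow> 's \<Rightarrow> real"
  unfolding covered_error_def by (intro Max0_ge finite_pair_values) auto

lemma covered_error_le:
  fixes f :: "'s::finite \<Rightarrow> 's \<Rightarrow> real"
  assumes "0 \<le> c" "\<And>s s'. {s, s'} \<in> C \<Longrightarrow> \<bar>f s s' - d s s'\<bar> \<le> c"
  shows "covered_error C f d \<le> c"
  unfolding covered_error_def using assms by (intro Max0_le finite_pair_values) auto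

lemma uncovered_gap_ge: "{s, s'} \<in> state_pairs - C \<Longrightarrow> d s s' - d0 s s' \<le> uncovered_gap C d0 d"
  for d :: "'s::finite \<Rightarrow> 's \<Rightarrow> real"
  unfolding uncovered_gap_def by (intro Max0_ge finite_pair_values) auto

text \<open>If some pair is uncovered, its own gap is a nonnegative lower bound; otherwise the
  convention for the empty maximum gives 0.\<close>

lemma uncovered_gap_nonneg:
  fixes d :: "'s::finite \<Rightarrow> 's \<Rightarrow> real"
  assumes "\<And>s s'. d0 s s' \<le> d s s'"
  shows "0 \<le> uncovered_gap C d0 d"
proof (cases "\<exists>s s'. {s, s'} \<in> state_pairs - C")
  case True
  then obtain s s' where "{s, s'} \<in> state_pairs - C" by blast
  from uncovered_gap_ge[OF this, of d d0] assms[of s s'] show ?thesis by simp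
next
  case False
  then have "{d s s' - d0 s s' | s s'. {s, s'} \<in> state_pairs - C} = {}" by blast
  then show ?thesis by (simp only: uncovered_gap_def Max0_def) simp
qed

lemma in_state_pairs_iff: "{s, s'} \<in> state_pairs \<longleftrightarrow> s \<noteq> s'"
  by (auto simp: state_pairs_def doubleton_eq_iff)

section \<open>Perturbation and symmetry of the transport cost\<close>

lemma sum_pmf_pairs: "(\<Sum>x\<in>UNIV. \<Sum>y\<in>UNIV. pmf \<pi> (x, y)) = 1"
  for \<pi> :: "('s::finite \<times> 's) pmf"
proof -
  have "(\<Sum>x\<in>UNIV. \<Sum>y\<in>UNIV. pmf \<pi> (x, y)) = (\<Sum>z\<in>UNIV. pmf \<pi> z)"
    by (simp add: sum.cartesian_product)
  also have "\<dots> = 1" by (intro sum_pmf_eq_1) auto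
  finally show ?thesis .
qed

text \<open>A coupling has total mass 1, so a constant added to the cost function adds exactly that
  constant to the transport cost.\<close>

lemma transport_cost_le:
  assumes "\<And>x y. f x y \<le> g x y + c"
  shows "transport_cost f \<pi> \<le> transport_cost g \<pi> + c"
proof -
  have "transport_cost f \<pi> \<le> (\<Sum>x\<in>UNIV. \<Sum>y\<in>UNIV. (g x y + c) * pmf \<pi> (x, y))"
    unfolding transport_cost_def using assms by (intro sum_mono mult_right_mono) auto
  also have "\<dots> = transport_cost g \<pi> + c * (\<Sum>x\<in>UNIV. \<Sum>y\<in>UNIV. pmf \<pi> (x, y))"
    by (simp add: transport_cost_def algebra_simps sum.distrib sum_distrib_left)
  finally show ?thesis by (simp add: sum_pmf_pairs)
qed

text \<open>A coupling that is optimal for \<open>g\<close> is still admissible for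
  \<open>f\<close>, so its \<open>f\<close>-cost bounds the minimum for \<open>f\<close>.\<close>

lemma W1_le:
  assumes "\<And>x y. f x y \<le> g x y + c"
  shows "W1 f \<mu> \<nu> \<le> W1 g \<mu> \<nu> + c"
proof -
  obtain \<pi> where \<pi>: "\<pi> \<in> couplings \<mu> \<nu>" "W1 g \<mu> \<nu> = transport_cost g \<pi>"
    using W1_attained by blast
  have "W1 f \<mu> \<nu> \<le> transport_cost f \<pi>"
    using W1_attained[of \<mu> \<nu> f] \<pi>(1) by auto
  with transport_cost_le[of f g c \<pi>] assms \<pi>(2) show ?thesis by simp
qed

lemma W1_zero: "W1 (\<lambda>x y. 0) \<mu> \<nu> = 0"
  using W1_attained[of \<mu> \<nu> "\<lambda>x y. 0"] by (auto simp: transport_cost_def)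

text \<open>Swapping the coordinates of an optimal coupling reverses its marginals and, as
  \<open>f\<close> is symmetric, keeps its cost. No triangle inequality enters.\<close>

lemma W1_commute_le:
  assumes "\<And>x y. f x y = f y x"
  shows "W1 f \<nu> \<mu> \<le> W1 f \<mu> \<nu>"
proof -
  obtain \<pi> where \<pi>: "\<pi> \<in> couplings \<mu> \<nu>" "W1 f \<mu> \<nu> = transport_cost f \<pi>"
    using W1_attained by blast
  have pmf_swap: "pmf (map_pmf prod.swap \<pi>) (x, y) = pmf \<pi> (y, x)" for x y
    using pmf_map_inj'[of prod.swap \<pi> "(y, x)"] by simp
  have "map_pmf prod.swap \<pi> \<in> couplings \<nu> \<mu>"
    using \<pi>(1) by (auto simp: couplings_def map_pmf_comp)
  moreover have "transport_cost f (map_pmf prod.swap \<pi>) = transport_cost f \<pi>"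
    unfolding transport_cost_def pmf_swap by (subst sum.swap) (simp add: assms)
  ultimately show ?thesis
    using W1_attained[of \<nu> \<mu> f] \<pi>(2) by metis
qed

lemma W1_commute: "(\<And>x y. f x y = f y x) \<Longrightarrow> W1 f \<mu> \<nu> = W1 f \<nu> \<mu>"
  using W1_commute_le[of f \<mu> \<nu>] W1_commute_le[of f \<nu> \<mu>] by fastforce

section \<open>The backup operator: monotonicity, contraction, bounds, continuity\<close>

text \<open>One-sided form of the contraction estimate: \<open>c = 0\<close> gives monotonicity, and
  using it in both directions gives the Lipschitz bound. On the diagonal it reduces to 0 \<le>
  \<gamma> c.\<close>

lemma bisim_op_le:
  assumes "0 \<le> \<gamma>" "0 \<le> c" "\<And>x y. f x y \<le> g x y + c"
  shows "bisim_op P R \<gamma> f s s' \<le> bisim_op P R \<gamma> g s s' + \<gamma> * c"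
proof (cases "s = s'")
  case True
  with assms show ?thesis by (simp add: bisim_op_def)
next
  case False
  let ?v = "\<lambda>h a. \<bar>R s a - R s' a\<bar> + \<gamma> * W1 h (P s a) (P s' a)"
  have "?v f a \<le> (MAX a. ?v g a) + \<gamma> * c" for a
  proof -
    have "\<gamma> * W1 f (P s a) (P s' a) \<le> \<gamma> * (W1 g (P s a) (P s' a) + c)"
      using assms by (intro mult_left_mono W1_le) auto
    then have "?v f a \<le> ?v g a + \<gamma> * c" by (simp add: distrib_left)
    also have "?v g a \<le> (MAX a. ?v g a)" by (intro Max_ge) auto
    finally show ?thesis by simp
  qed
  then have "(MAX a. ?v f a) \<le> (MAX a. ?v g a) + \<gamma> * c"
    by (subst Max_le_iff) auto
  with False show ?thesis by (simp add: bisim_op_def)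
qed

lemma bisim_op_mono:
  assumes "0 \<le> \<gamma>" "\<And>x y. f x y \<le> g x y"
  shows "bisim_op P R \<gamma> f s s' \<le> bisim_op P R \<gamma> g s s'"
  using bisim_op_le[of \<gamma> 0 f g P R s s'] assms by simp

lemma bisim_op_lipschitz:
  assumes "0 \<le> \<gamma>" "\<And>x y. \<bar>f x y - g x y\<bar> \<le> c"
  shows "\<bar>bisim_op P R \<gamma> f s s' - bisim_op P R \<gamma> g s s'\<bar> \<le> \<gamma> * c"
proof -
  have "f x y \<le> g x y + c" "g x y \<le> f x y + c" for x y
    using assms(2)[of x y] by linarith+
  moreover have "0 \<le> c" using assms(2)[of undefined undefined] by linarith
  ultimately have "bisim_op P R \<gamma> f s s' \<le> bisim_op P R \<gamma> g s s' + \<gamma> * c"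
    "bisim_op P R \<gamma> g s s' \<le> bisim_op P R \<gamma> f s s' + \<gamma> * c"
    using assms(1) by (auto intro!: bisim_op_le)
  then show ?thesis by linarith
qed

text \<open>Transport at zero cost is free, so only rewards remain: the start
  \<open>reward_dist R\<close> is one backup of 0 off the diagonal.\<close>

lemma bisim_op_zero: "s \<noteq> s' \<Longrightarrow> bisim_op P R \<gamma> (\<lambda>x y. 0) s s' = reward_dist R s s'"
  by (simp add: bisim_op_def reward_dist_def W1_zero)

lemma reward_dist_nonneg: "0 \<le> reward_dist R s s'"
  unfolding reward_dist_def by (subst Max_ge_iff) auto

lemma reward_dist_le:
  assumes "\<And>s a. 0 \<le> R s a \<and> R s a \<le> L"
  shows "reward_dist R s s' \<le> L"
proof -
  have "\<bar>R s a - R s' a\<bar> \<le> L" for a using assms[of s a] assms[of s' a] by linarith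
  then show ?thesis unfolding reward_dist_def by (subst Max_le_iff) auto
qed

text \<open>Compare with the backup of 0, which is at most L in absolute value; the contraction
  estimate accounts for the remaining \<gamma> c.\<close>

lemma bisim_op_abs_le:
  assumes "\<And>s a. 0 \<le> R s a \<and> R s a \<le> L" "0 \<le> \<gamma>" "\<And>x y. \<bar>f x y\<bar> \<le> c"
  shows "\<bar>bisim_op P R \<gamma> f s s'\<bar> \<le> L + \<gamma> * c"
proof -
  have "\<bar>bisim_op P R \<gamma> (\<lambda>x y. 0) s s'\<bar> \<le> L"
  proof (cases "s = s'")
    case True
    have "0 \<le> L" using assms(1)[of undefined undefined] by linarith
    with True show ?thesis by (simp add: bisim_op_def)
  next
    case False
    then show ?thesis
      using reward_dist_nonneg[of R s s'] reward_dist_le[of R L s s'] assms(1)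
      by (simp add: bisim_op_zero)
  qed
  moreover have "\<bar>bisim_op P R \<gamma> f s s' - bisim_op P R \<gamma> (\<lambda>x y. 0) s s'\<bar> \<le> \<gamma> * c"
    using assms by (intro bisim_op_lipschitz) auto
  ultimately show ?thesis by linarith
qed

lemma bisim_op_pair_function:
  assumes "pair_function f"
  shows "pair_function (bisim_op P R \<gamma> f)"
proof -
  have "f x y = f y x" for x y using assms by (auto simp: pair_function_def)
  then have "W1 f \<mu> \<nu> = W1 f \<nu> \<mu>" for \<mu> \<nu> by (rule W1_commute)
  then show ?thesis
    by (auto simp: pair_function_def bisim_op_def abs_minus_commute)
qed

lemma bisim_op_tendsto:
  assumes "0 \<le> \<gamma>" "pointwise_limit F g"
  shows "(\<lambda>t. bisim_op P R \<gamma> (F t) s s') \<longlonglongrightarrow> bisim_op P R \<gamma> g s s'"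
proof -
  \<comment> \<open>The sum of all deviations dominates each of them and, being finite, tends to 0
    termwise; it turns pointwise convergence into a uniform bound.\<close>
  define c where "c t = (\<Sum>x\<in>UNIV. \<Sum>y\<in>UNIV. \<bar>F t x y - g x y\<bar>)" for t
  have le: "\<bar>F t x y - g x y\<bar> \<le> c t" for t x y
  proof -
    have "\<bar>F t x y - g x y\<bar> \<le> (\<Sum>y\<in>UNIV. \<bar>F t x y - g x y\<bar>)"
      by (rule member_le_sum) auto
    also have "\<dots> \<le> c t"
      unfolding c_def by (rule member_le_sum) (auto intro: sum_nonneg)
    finally show ?thesis .
  qed
  have "(\<lambda>t. F t x y) \<longlonglongrightarrow> g x y" for x y
    using assms(2) by (auto simp: pointwise_limit_def)
  then have "(\<lambda>t. \<gamma> * c t) \<longlonglongrightarrow> \<gamma> * (\<Sum>x\<in>UNIV. \<Sum>y\<in>UNIV. \<bar>g x y - g x y\<bar>)"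
    unfolding c_def by (intro tendsto_intros)
  then have lim: "(\<lambda>t. \<gamma> * c t) \<longlonglongrightarrow> 0" by simp
  have "(\<lambda>t. bisim_op P R \<gamma> (F t) s s' - bisim_op P R \<gamma> g s s') \<longlonglongrightarrow> 0"
    using lim by (rule Lim_null_comparison[rotated])
      (auto intro!: always_eventually bisim_op_lipschitz assms(1) le)
  then show ?thesis by (simp add: LIM_zero_iff)
qed

section \<open>Fixed points of the restricted iteration\<close>

text \<open>Two solutions agree off \<open>C\<close>, and on \<open>C\<close> the contraction
  shrinks their distance, so that distance is at most \<gamma> times itself.\<close>

lemma restricted_fixed_point_unique:
  assumes "0 \<le> \<gamma>" "\<gamma> < 1"
    and f: "restricted_fixed_point P R \<gamma> C d0 f" and g: "restricted_fixed_point P R \<gamma> C d0 g"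
  shows "f = g"
proof -
  let ?c = "sup_norm (f - g)"
  have c: "\<bar>f s s' - g s s'\<bar> \<le> ?c" for s s'
    using abs_le_sup_norm[of "f - g"] by simp
  have "0 \<le> ?c" using c[of undefined undefined] by linarith
  have "\<bar>(f - g) s s'\<bar> \<le> \<gamma> * ?c" for s s'
  proof (cases "{s, s'} \<in> C")
    case True
    with f g have "f s s' = bisim_op P R \<gamma> f s s'" "g s s' = bisim_op P R \<gamma> g s s'"
      by (auto simp: restricted_fixed_point_def)
    with bisim_op_lipschitz[of \<gamma> f g ?c P R s s'] assms(1) c show ?thesis by simp
  next
    case False
    with f g \<open>0 \<le> \<gamma>\<close> \<open>0 \<le> ?c\<close> show ?thesis by (auto simp: restricted_fixed_point_def)
  qed
  then have "?c \<le> \<gamma> * ?c" by (rule sup_norm_le)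
  then have "(1 - \<gamma>) * ?c \<le> 0" by (simp add: algebra_simps)
  with assms(2) have "?c \<le> 0" by (simp add: mult_le_0_iff)
  with c have "\<bar>f s s' - g s s'\<bar> \<le> 0" for s s' by (meson order_trans)
  then show ?thesis by (intro ext) simp
qed

text \<open>The sub-solution property makes the first step an increase, and monotonicity of the
  backup propagates it. \<open>F\<close> is any sequence obeying the recursion, so that the result
  serves both the powers of the full operator and the covered iterates of an exact backup.\<close>

lemma restricted_iteration:
  fixes F :: "nat \<Rightarrow> 's::finite \<Rightarrow> 's \<Rightarrow> real" and R :: "'s \<Rightarrow> 'a::finite \<Rightarrow> real"
  assumes R: "\<And>s a. 0 \<le> R s a \<and> R s a \<le> L"
    and gamma: "0 \<le> \<gamma>" "\<gamma> < 1"
    and d0_nonneg: "\<And>s s'. 0 \<le> d0 s s'"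
    and d0_le: "\<And>s s'. d0 s s' \<le> L / (1 - \<gamma>)"
    and sub: "\<And>s s'. {s, s'} \<in> C \<Longrightarrow> d0 s s' \<le> bisim_op P R \<gamma> d0 s s'"
    and F_0: "F 0 = d0"
    and F_Suc: "\<And>t s s'. F (Suc t) s s' =
      (if {s, s'} \<in> C then bisim_op P R \<gamma> (F t) s s' else d0 s s')"
    and F_pair: "\<And>t. pair_function (F t)"
  obtains g where "restricted_fixed_point P R \<gamma> C d0 g" "pointwise_limit F g"
    "\<And>t s s'. F t s s' \<le> F (Suc t) s s'"
proof -
  have mono: "F t s s' \<le> F (Suc t) s s'" for t s s'
  proof (induction t arbitrary: s s')
    case 0
    then show ?case using sub by (simp add: F_Suc F_0)
  next
    case (Suc t)
    then show ?case
      using bisim_op_mono[OF gamma(1), of "F t" "F (Suc t)" P R s s']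
      by (simp add: F_Suc[of "Suc t"] F_Suc[of t s s'])
  qed
  have bound: "\<bar>F t s s'\<bar> \<le> L / (1 - \<gamma>)" for t s s'
  proof (induction t arbitrary: s s')
    case 0
    then show ?case using d0_nonneg[of s s'] d0_le[of s s'] by (simp add: F_0)
  next
    case (Suc t)
    \<comment> \<open>The radius is the fixed point of x \<mapsto> L + \<gamma> x, so the ball is
      mapped into itself.\<close>
    have "L + \<gamma> * (L / (1 - \<gamma>)) = L / (1 - \<gamma>)" using gamma by (simp add: field_simps)
    with bisim_op_abs_le[of R L \<gamma> "F t" "L / (1 - \<gamma>)" P s s'] R gamma Suc
    show ?case using d0_nonneg[of s s'] d0_le[of s s'] by (simp add: F_Suc)
  qed
  define g where "g s s' = lim (\<lambda>t. F t s s')" for s s'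
  have lim: "(\<lambda>t. F t s s') \<longlonglongrightarrow> g s s'" for s s'
  proof -
    have "incseq (\<lambda>t. F t s s')" using mono by (intro incseq_SucI)
    moreover have "F t s s' \<le> L / (1 - \<gamma>)" for t using bound[of t s s'] by linarith
    ultimately have "convergent (\<lambda>t. F t s s')"
      by (metis incseq_convergent convergentI)
    then show ?thesis by (simp add: g_def convergent_LIMSEQ_iff)
  qed
  then have lim_g: "pointwise_limit F g" by (simp add: pointwise_limit_def)
  \<comment> \<open>On a covered pair the shifted sequence tends to \<open>g s s'\<close> and, by
    continuity of the backup, also to the backup of \<open>g\<close>.\<close>
  have "g s s' = bisim_op P R \<gamma> g s s'" if "{s, s'} \<in> C" for s s'
    using LIMSEQ_unique[OF LIMSEQ_Suc[OF lim[of s s']]]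
      bisim_op_tendsto[OF gamma(1) lim_g, of P R s s'] that by (simp add: F_Suc)
  moreover have "g s s' = d0 s s'" if "{s, s'} \<notin> C" for s s'
    using LIMSEQ_unique[OF LIMSEQ_Suc[OF lim[of s s']], of "d0 s s'"] that by (simp add: F_Suc)
  moreover have "pair_function g"
    using F_pair by (auto simp: pair_function_def g_def)
  ultimately have "restricted_fixed_point P R \<gamma> C d0 g"
    by (simp add: restricted_fixed_point_def)
  then show ?thesis using lim_g mono that by blast
qed

section \<open>Existence and size of the bisimulation metric\<close>

text \<open>When every pair of distinct states is covered, only the diagonal remains, and there all
  the functions involved vanish.\<close>

lemma restricted_fixed_point_state_pairs:
  "restricted_fixed_point P R \<gamma> state_pairs (\<lambda>s s'. 0) g \<longleftrightarrow>
    pair_function g \<and> bisim_op P R \<gamma> g = g"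
proof -
  have "bisim_op P R \<gamma> g s s = 0" for s by (simp add: bisim_op_def)
  then show ?thesis
    unfolding restricted_fixed_point_def in_state_pairs_iff pair_function_def fun_eq_iff
    by metis
qed

text \<open>Iterating from the sub-solution 0 gives existence and the contraction gives uniqueness,
  so the definite description denotes the fixed point.\<close>

lemma bisim_metric_fixed_point:
  assumes R: "\<And>s a. 0 \<le> R s a \<and> R s a \<le> L" and gamma: "0 \<le> \<gamma>" "\<gamma> < 1"
  shows "pair_function (bisim_metric P R \<gamma>)"
    and "bisim_op P R \<gamma> (bisim_metric P R \<gamma>) = bisim_metric P R \<gamma>"
proof -
  define F where "F t = (bisim_op P R \<gamma> ^^ t) (\<lambda>s s'. 0)" for t
  have pair: "pair_function (F t)" for t
    by (induction t) (auto simp: F_def pair_function_def[of "\<lambda>s s'. 0"] bisim_op_pair_function)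
  have "0 \<le> L" using R[of undefined undefined] by linarith
  have "F (Suc t) s s' = (if {s, s'} \<in> state_pairs then bisim_op P R \<gamma> (F t) s s' else 0)" for t s s'
    by (simp add: F_def in_state_pairs_iff bisim_op_def)
  moreover have "0 \<le> bisim_op P R \<gamma> (\<lambda>s s'. 0) s s'" if "{s, s'} \<in> state_pairs" for s s'
    using that by (simp add: in_state_pairs_iff bisim_op_zero reward_dist_nonneg)
  moreover have "F 0 = (\<lambda>s s'. 0)" by (simp add: F_def)
  moreover have "0 \<le> L / (1 - \<gamma>)" using \<open>0 \<le> L\<close> gamma by simp
  ultimately obtain g where "restricted_fixed_point P R \<gamma> state_pairs (\<lambda>s s'. 0) g"
    using restricted_iteration[of R L \<gamma> "\<lambda>s s'. 0" state_pairs P F, OF R gamma order_refl _ _ _ _ pair]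
    by metis
  then have "\<exists>!g. pair_function g \<and> bisim_op P R \<gamma> g = g"
    using restricted_fixed_point_unique[OF gamma]
    unfolding restricted_fixed_point_state_pairs[symmetric] by blast
  from theI'[OF this]
  show "pair_function (bisim_metric P R \<gamma>)"
    "bisim_op P R \<gamma> (bisim_metric P R \<gamma>) = bisim_metric P R \<gamma>"
    by (simp_all add: bisim_metric_def)
qed

lemma bisim_metric_le:
  assumes R: "\<And>s a. 0 \<le> R s a \<and> R s a \<le> L" and gamma: "0 \<le> \<gamma>" "\<gamma> < 1"
  shows "\<bar>bisim_metric P R \<gamma> s s'\<bar> \<le> L / (1 - \<gamma>)"
proof -
  let ?d = "bisim_metric P R \<gamma>"
  have "\<bar>?d s s'\<bar> \<le> L + \<gamma> * sup_norm ?d" for s s'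
    using bisim_op_abs_le[of R L \<gamma> ?d "sup_norm ?d" P s s'] R gamma(1)
    by (simp add: abs_le_sup_norm bisim_metric_fixed_point(2)[of R L, OF R gamma])
  then have "sup_norm ?d \<le> L + \<gamma> * sup_norm ?d" by (rule sup_norm_le)
  then have "sup_norm ?d \<le> L / (1 - \<gamma>)" using gamma by (simp add: field_simps)
  with abs_le_sup_norm[of ?d s s'] show ?thesis by linarith
qed

section \<open>Iterates of an approximate backup\<close>

text \<open>Symmetry is built into backup values on unordered pairs. Singletons are not in
  \<open>C\<close>, so the diagonal always keeps the value 0 of \<open>d0\<close>.\<close>

lemma covered_iter_pair_function:
  assumes "C \<subseteq> state_pairs" "pair_function d0"
  shows "pair_function (covered_iter C B d0 t)"
proof (cases t)
  case (Suc n)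
  have "{s} \<notin> C" for s using assms(1) in_state_pairs_iff[of s s] by auto
  with assms(2) Suc show ?thesis by (auto simp: pair_function_def insert_commute)
qed (use assms in simp)

lemma covered_iter_uncovered: "{s, s'} \<notin> C \<Longrightarrow> covered_iter C B d0 t s s' = d0 s s'"
  by (cases t) auto

text \<open>The accuracy of \<open>B\<close> is guaranteed only within this radius, so the iterates
  must be shown never to leave it.\<close>

lemma covered_iter_abs_le:
  assumes R: "\<And>s a. 0 \<le> R s a \<and> R s a \<le> L" and gamma: "0 \<le> \<gamma>" "\<gamma> < 1"
    and "C \<subseteq> state_pairs" "pair_function d0" "0 \<le> \<epsilon>"
    and d0_le: "\<And>s s'. \<bar>d0 s s'\<bar> \<le> L / (1 - \<gamma>)"
    and backup: "approx_covered_backup P R \<gamma> L C \<epsilon> B"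
  shows "\<bar>covered_iter C B d0 t s s'\<bar> \<le> L / (1 - \<gamma>) + \<epsilon> / (1 - \<gamma>)" (is "_ \<le> ?D")
proof -
  have "0 \<le> \<epsilon> / (1 - \<gamma>)" using \<open>0 \<le> \<epsilon>\<close> gamma by simp
  then have d0_le': "\<bar>d0 s s'\<bar> \<le> ?D" for s s' using d0_le[of s s'] by linarith
  show ?thesis
  proof (induction t arbitrary: s s')
    case 0
    then show ?case using d0_le' by simp
  next
    case (Suc t)
    let ?f = "covered_iter C B d0 t"
    show ?case
    proof (cases "{s, s'} \<in> C")
      case True
      have "pair_function ?f" using assms by (intro covered_iter_pair_function)
      moreover have "sup_norm ?f \<le> ?D" using Suc by (rule sup_norm_le)
      ultimately have "\<bar>B ?f {s, s'} - bisim_op P R \<gamma> ?f s s'\<bar> \<le> \<epsilon>"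
        using backup True by (auto simp: approx_covered_backup_def)
      moreover have "\<bar>bisim_op P R \<gamma> ?f s s'\<bar> \<le> L + \<gamma> * ?D"
        using R gamma(1) Suc by (rule bisim_op_abs_le)
      \<comment> \<open>The radius is the fixed point of x \<mapsto> \<epsilon> + L + \<gamma> x:
        one inexact backup reproduces it.\<close>
      moreover have "\<epsilon> + (L + \<gamma> * ?D) = ?D"
        using gamma by (simp add: add_divide_distrib[symmetric] field_simps)
      ultimately show ?thesis using True by simp
    qed (use d0_le' in simp)
  qed
qed

text \<open>Insert the exact backup of the iterate: the backup error costs \<epsilon>, and the
  distance from there to \<open>d\<close>, which is its own backup, costs \<gamma> c.\<close>

lemma covered_backup_error:
  assumes R: "\<And>s a. 0 \<le> R s a \<and> R s a \<le> L" and gamma: "0 \<le> \<gamma>" "\<gamma> < 1"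
    and "C \<subseteq> state_pairs" "pair_function d0" "0 \<le> \<epsilon>"
    and d0_le: "\<And>s s'. \<bar>d0 s s'\<bar> \<le> L / (1 - \<gamma>)"
    and backup: "approx_covered_backup P R \<gamma> L C \<epsilon> B"
    and d_fix: "bisim_op P R \<gamma> d = d"
    and err: "\<And>x y. \<bar>covered_iter C B d0 t x y - d x y\<bar> \<le> c"
    and pair: "{s, s'} \<in> C"
  shows "\<bar>covered_iter C B d0 (Suc t) s s' - d s s'\<bar> \<le> \<epsilon> + \<gamma> * c"
proof -
  let ?f = "covered_iter C B d0 t"
  have "pair_function ?f" using assms by (intro covered_iter_pair_function)
  moreover have "sup_norm ?f \<le> L / (1 - \<gamma>) + \<epsilon> / (1 - \<gamma>)"
    using assms by (intro sup_norm_le covered_iter_abs_le)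
  ultimately have "\<bar>B ?f {s, s'} - bisim_op P R \<gamma> ?f s s'\<bar> \<le> \<epsilon>"
    using backup pair by (auto simp: approx_covered_backup_def)
  moreover have "\<bar>bisim_op P R \<gamma> ?f s s' - d s s'\<bar> \<le> \<gamma> * c"
    using bisim_op_lipschitz[of \<gamma> ?f d c P R s s'] gamma(1) err d_fix by simp
  ultimately show ?thesis using pair by simp
qed

section \<open>Error bounds, limit points and the exact case\<close>

theorem theorem2:
  fixes P :: "'s::finite \<Rightarrow> 'a::finite \<Rightarrow> 's pmf"
    and R :: "'s \<Rightarrow> 'a \<Rightarrow> real"
    and L \<gamma> \<epsilon> \<Delta>0 \<rho> :: real
    and d d0 :: "'s \<Rightarrow> 's \<Rightarrow> real"
    and C :: "'s set set"
    and B :: "('s \<Rightarrow> 's \<Rightarrow> real) \<Rightarrow> 's set \<Rightarrow> real"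
    and f :: "nat \<Rightarrow> 's \<Rightarrow> 's \<Rightarrow> real"
    and e :: "nat \<Rightarrow> real"
  assumes R_range: "\<And>s a. 0 \<le> R s a \<and> R s a \<le> L"
    and gamma: "0 \<le> \<gamma>" "\<gamma> < 1"
    and d_eq: "d = bisim_metric P R \<gamma>"
    and covered: "C \<subseteq> state_pairs"
    and d0_pair: "pair_function d0"
    and d0_bounds: "\<And>s s'. 0 \<le> d0 s s' \<and> d0 s s' \<le> d s s'"
    and eps: "0 \<le> \<epsilon>"
    and backup: "approx_covered_backup P R \<gamma> L C \<epsilon> B"
    and f_eq: "f = covered_iter C B d0"
    and Delta0_eq: "\<Delta>0 = sup_norm (d0 - d)"
    and rho_eq: "\<rho> = uncovered_gap C d0 d"
    and e_eq: "\<And>t. e t = covered_error C (f t) d"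
  shows
    "(\<forall>t. e t \<le> max (\<epsilon> / (1 - \<gamma>)) (\<epsilon> + \<gamma> * \<rho>) + \<gamma> ^ t * \<Delta>0)
     \<and> ((\<forall>t. sup_norm (f t - d) \<le> max \<rho> (\<epsilon> / (1 - \<gamma>)) + \<gamma> ^ t * \<Delta>0)
        \<and> (\<forall>dh. is_limit_point f dh \<longrightarrow> sup_norm (dh - d) \<le> max \<rho> (\<epsilon> / (1 - \<gamma>))))
     \<and> (C = state_pairs \<longrightarrow>
          \<rho> = 0 \<and> (\<forall>t. sup_norm (f t - d) \<le> \<epsilon> / (1 - \<gamma>) + \<gamma> ^ t * \<Delta>0))
     \<and> (exact_covered_backup P R \<gamma> C B \<and>
        (d0 = (\<lambda>s s'. 0) \<or> d0 = reward_dist R \<or>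
         (\<forall>s s'. {s, s'} \<in> C \<longrightarrow> d0 s s' \<le> bisim_op P R \<gamma> d0 s s')) \<longrightarrow>
          (\<exists>dh. restricted_fixed_point P R \<gamma> C d0 dh
             \<and> (\<forall>g. restricted_fixed_point P R \<gamma> C d0 g \<longrightarrow> g = dh)
             \<and> (\<forall>t s s'. f t s s' \<le> f (Suc t) s s')
             \<and> pointwise_limit f dh
             \<and> (\<forall>s s'. d0 s s' \<le> dh s s' \<and> dh s s' \<le> d s s')
             \<and> covered_error C dh d \<le> \<gamma> * \<rho>))"
proof -
  let ?M = "max \<rho> (\<epsilon> / (1 - \<gamma>))" and ?N = "max (\<epsilon> / (1 - \<gamma>)) (\<epsilon> + \<gamma> * \<rho>)"
  have d_pair: "pair_function d" and d_fix: "bisim_op P R \<gamma> d = d"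
    unfolding d_eq using bisim_metric_fixed_point[of R L, OF R_range gamma] by simp_all
  have d_le: "\<bar>d s s'\<bar> \<le> L / (1 - \<gamma>)" for s s'
    unfolding d_eq by (rule bisim_metric_le[of R L, OF R_range gamma])
  have d0_le: "\<bar>d0 s s'\<bar> \<le> L / (1 - \<gamma>)" for s s'
    using d0_bounds[of s s'] d_le[of s s'] by linarith
  have Delta0: "\<bar>d0 s s' - d s s'\<bar> \<le> \<Delta>0" for s s'
    using abs_le_sup_norm[of "d0 - d"] by (simp add: Delta0_eq)
  have Delta0_nonneg: "0 \<le> \<gamma> ^ t * \<Delta>0" for t
    using Delta0[of undefined undefined] gamma(1) by simp
  have rho_nonneg: "0 \<le> \<rho>"
    unfolding rho_eq using d0_bounds by (intro uncovered_gap_nonneg) auto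
  have eps': "0 \<le> \<epsilon> / (1 - \<gamma>)" using eps gamma by simp
  \<comment> \<open>The hypothesis also admits the diagonal, which \<rho> does not range over; there
    both functions vanish.\<close>
  have gap: "\<bar>d0 s s' - d s s'\<bar> \<le> \<rho>" if "{s, s'} \<notin> C" for s s'
  proof (cases "s = s'")
    case True
    then show ?thesis using d0_pair d_pair rho_nonneg by (simp add: pair_function_def)
  next
    case False
    then have "{s, s'} \<in> state_pairs - C" using that by (simp add: in_state_pairs_iff)
    from uncovered_gap_ge[OF this, of d d0] d0_bounds[of s s'] show ?thesis by (simp add: rho_eq)
  qed
  have uncovered: "\<bar>f t s s' - d s s'\<bar> \<le> \<rho>" if "{s, s'} \<notin> C" for t s s'
    using gap[OF that] covered_iter_uncovered[OF that] by (simp add: f_eq)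
  \<comment> \<open>As \<epsilon> / (1 - \<gamma>) is fixed by x \<mapsto> \<epsilon> + \<gamma> x,
    this map sends the constant \<open>?M\<close> of (B) to the constant \<open>?N\<close> of
    (A).\<close>
  have "\<epsilon> + \<gamma> * (\<epsilon> / (1 - \<gamma>)) = \<epsilon> / (1 - \<gamma>)" using gamma by (simp add: field_simps)
  then have N_eq: "\<epsilon> + \<gamma> * ?M = ?N"
    using gamma(1) by (simp add: max_mult_distrib_left max_add_distrib_right max.commute)
  have "\<epsilon> / (1 - \<gamma>) \<le> ?M" by simp
  then have "\<epsilon> \<le> ?M * (1 - \<gamma>)" using gamma pos_divide_le_eq[of "1 - \<gamma>" \<epsilon> ?M] by simp
  then have N_le: "?N \<le> ?M" unfolding N_eq[symmetric] by (simp add: algebra_simps)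
  have step: "\<bar>f (Suc t) s s' - d s s'\<bar> \<le> ?N + \<gamma> ^ Suc t * \<Delta>0"
    if "\<And>x y. \<bar>f t x y - d x y\<bar> \<le> ?M + \<gamma> ^ t * \<Delta>0" "{s, s'} \<in> C" for t s s'
  proof -
    have "\<bar>f (Suc t) s s' - d s s'\<bar> \<le> \<epsilon> + \<gamma> * (?M + \<gamma> ^ t * \<Delta>0)"
      using that unfolding f_eq
      by (intro covered_backup_error[of R L, OF R_range gamma covered d0_pair eps d0_le backup d_fix])
    moreover have "\<gamma> * (?M + \<gamma> ^ t * \<Delta>0) = \<gamma> * ?M + \<gamma> ^ Suc t * \<Delta>0"
      by (simp add: distrib_left mult.assoc)
    ultimately show ?thesis using N_eq by linarith
  qed
  have err: "\<bar>f t s s' - d s s'\<bar> \<le> ?M + \<gamma> ^ t * \<Delta>0" for t s s'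
  proof (induction t arbitrary: s s')
    case 0
    then show ?case using Delta0[of s s'] rho_nonneg by (simp add: f_eq)
  next
    case (Suc t)
    show ?case
    proof (cases "{s, s'} \<in> C")
      case True
      from step[OF Suc True] N_le show ?thesis by linarith
    next
      case False
      from uncovered[OF False, of "Suc t"] Delta0_nonneg[of "Suc t"] show ?thesis by linarith
    qed
  qed
  have A: "e t \<le> ?N + \<gamma> ^ t * \<Delta>0" for t
    unfolding e_eq
  proof (rule covered_error_le)
    show "0 \<le> ?N + \<gamma> ^ t * \<Delta>0" using eps' Delta0_nonneg[of t] by linarith
    fix s s' assume "{s, s'} \<in> C"
    show "\<bar>f t s s' - d s s'\<bar> \<le> ?N + \<gamma> ^ t * \<Delta>0"
    \<comment> \<open>At time 0 no backup has been made and \<Delta>0 alone suffices; later times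
      gain the sharper \<open>?N\<close> from one backup of the bound for all pairs.\<close>
    proof (cases t)
      case 0
      then show ?thesis using Delta0[of s s'] eps' by (simp add: f_eq)
    next
      case (Suc n)
      then show ?thesis using step[OF err \<open>{s, s'} \<in> C\<close>] by simp
    qed
  qed
  have B1: "sup_norm (f t - d) \<le> ?M + \<gamma> ^ t * \<Delta>0" for t
    using err by (intro sup_norm_le) simp
  have B2: "sup_norm (dh - d) \<le> ?M" if "is_limit_point f dh" for dh
  proof (rule sup_norm_le)
    fix s s'
    from that obtain r where r: "strict_mono r" "(\<lambda>n. f (r n) s s') \<longlonglongrightarrow> dh s s'"
      by (auto simp: is_limit_point_def pointwise_limit_def)
    have "(\<lambda>n. \<gamma> ^ r n) \<longlonglongrightarrow> 0"
      using LIMSEQ_subseq_LIMSEQ[OF LIMSEQ_realpow_zero[OF gamma] r(1)] by (simp add: comp_def)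
    then have "(\<lambda>n. ?M + \<gamma> ^ r n * \<Delta>0) \<longlonglongrightarrow> ?M + 0 * \<Delta>0" by (intro tendsto_intros)
    moreover have "(\<lambda>n. \<bar>f (r n) s s' - d s s'\<bar>) \<longlonglongrightarrow> \<bar>dh s s' - d s s'\<bar>"
      by (intro tendsto_intros r(2))
    ultimately have "\<bar>dh s s' - d s s'\<bar> \<le> ?M + 0 * \<Delta>0"
      using err by (intro LIMSEQ_le) auto
    then show "\<bar>(dh - d) s s'\<bar> \<le> ?M" by simp
  qed
  have C: "\<rho> = 0" "sup_norm (f t - d) \<le> \<epsilon> / (1 - \<gamma>) + \<gamma> ^ t * \<Delta>0"
    if "C = state_pairs" for t
  proof -
    show "\<rho> = 0" using that by (simp add: rho_eq uncovered_gap_def Max0_def)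
    with B1[of t] eps' show "sup_norm (f t - d) \<le> \<epsilon> / (1 - \<gamma>) + \<gamma> ^ t * \<Delta>0" by simp
  qed
  have D: "\<exists>dh. restricted_fixed_point P R \<gamma> C d0 dh
      \<and> (\<forall>g. restricted_fixed_point P R \<gamma> C d0 g \<longrightarrow> g = dh)
      \<and> (\<forall>t s s'. f t s s' \<le> f (Suc t) s s')
      \<and> pointwise_limit f dh
      \<and> (\<forall>s s'. d0 s s' \<le> dh s s' \<and> dh s s' \<le> d s s')
      \<and> covered_error C dh d \<le> \<gamma> * \<rho>"
    if exact: "exact_covered_backup P R \<gamma> C B"
      and start: "d0 = (\<lambda>s s'. 0) \<or> d0 = reward_dist R \<or>
         (\<forall>s s'. {s, s'} \<in> C \<longrightarrow> d0 s s' \<le> bisim_op P R \<gamma> d0 s s')"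
  proof -
    \<comment> \<open>Both named starts are sub-solutions: since \<open>d0\<close> is nonnegative,
      its backup on distinct states is at least that of 0, which is
      \<open>reward_dist R\<close>.\<close>
    have sub: "d0 s s' \<le> bisim_op P R \<gamma> d0 s s'" if "{s, s'} \<in> C" for s s'
    proof -
      from that covered have "{s, s'} \<in> state_pairs" by blast
      then have "s \<noteq> s'" by (simp add: in_state_pairs_iff)
      then have "reward_dist R s s' \<le> bisim_op P R \<gamma> d0 s s'"
        using bisim_op_mono[OF gamma(1), of "\<lambda>s s'. 0" d0 P R s s'] d0_bounds
        by (simp add: bisim_op_zero)
      then show ?thesis
        using start that reward_dist_nonneg[of R s s'] by (metis order_trans order_refl)
    qed
    have f_pair: "pair_function (f t)" for t
      unfolding f_eq by (rule covered_iter_pair_function[OF covered d0_pair])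
    have f_Suc: "f (Suc t) s s' = (if {s, s'} \<in> C then bisim_op P R \<gamma> (f t) s s' else d0 s s')"
      for t s s'
      using exact f_pair[of t] by (simp add: f_eq exact_covered_backup_def)
    have f_0: "f 0 = d0" by (simp add: f_eq)
    obtain dh where dh: "restricted_fixed_point P R \<gamma> C d0 dh" and lim: "pointwise_limit f dh"
      and mono: "\<And>t s s'. f t s s' \<le> f (Suc t) s s'"
    proof (rule restricted_iteration[of R L \<gamma> d0 C P f])
      show "d0 s s' \<le> L / (1 - \<gamma>)" for s s' using d0_le[of s s'] by linarith
    qed (use R_range gamma d0_bounds sub f_0 f_Suc f_pair in auto)
    \<comment> \<open>Monotonicity keeps the iterates below \<open>d\<close>, since \<open>d\<close>
      is its own backup.\<close>
    have f_le: "f t s s' \<le> d s s'" for t s s'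
    proof (induction t arbitrary: s s')
      case 0
      then show ?case using d0_bounds by (simp add: f_0)
    next
      case (Suc t)
      then show ?case
        using bisim_op_mono[OF gamma(1), of "f t" d P R s s'] d0_bounds[of s s']
        by (simp add: f_Suc d_fix)
    qed
    have lim': "(\<lambda>t. f t s s') \<longlonglongrightarrow> dh s s'" for s s'
      using lim by (simp add: pointwise_limit_def)
    have dh_le: "dh s s' \<le> d s s'" for s s'
      using lim' by (rule LIMSEQ_le_const2) (use f_le in auto)
    have le_dh: "d0 s s' \<le> dh s s'" for s s'
      using incseq_le[OF incseq_SucI lim', of s s' 0] mono by (simp add: f_0)
    let ?c = "covered_error C dh d"
    \<comment> \<open>The overall error of \<open>dh\<close> is at most the larger of \<rho> and the
      covered error; one backup then bounds the covered error by \<gamma> times that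
      maximum.\<close>
    have "\<bar>dh s s' - d s s'\<bar> \<le> max \<rho> ?c" for s s'
      using covered_error_ge[of s s' C dh d] gap[of s s'] dh
      by (cases "{s, s'} \<in> C") (auto simp: restricted_fixed_point_def)
    then have "\<bar>bisim_op P R \<gamma> dh s s' - bisim_op P R \<gamma> d s s'\<bar> \<le> \<gamma> * max \<rho> ?c" for s s'
      by (rule bisim_op_lipschitz[OF gamma(1)])
    then have "\<bar>dh s s' - d s s'\<bar> \<le> \<gamma> * max \<rho> ?c" if "{s, s'} \<in> C" for s s'
      using dh that d_fix unfolding restricted_fixed_point_def by metis
    moreover have "0 \<le> \<gamma> * max \<rho> ?c" using gamma(1) rho_nonneg by simp
    ultimately have c_le: "?c \<le> \<gamma> * max \<rho> ?c" by (intro covered_error_le)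
    have "?c \<le> \<gamma> * \<rho>"
    \<comment> \<open>Were the covered error above \<rho>, it would be at most \<gamma> times
      itself, hence at most 0, contradicting \<rho> \<ge> 0.\<close>
    proof (cases "?c \<le> \<rho>")
      case True
      with c_le show ?thesis by simp
    next
      case False
      with c_le have "(1 - \<gamma>) * ?c \<le> 0" by (simp add: algebra_simps)
      with gamma False rho_nonneg show ?thesis by (simp add: mult_le_0_iff)
    qed
    then show ?thesis
      using dh lim mono dh_le le_dh restricted_fixed_point_unique[OF gamma _ dh] by blast
  qed
  show ?thesis using A B1 B2 C D by blast
qed

end
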